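(* Let $0<q<1$, $\nu>-1$ and $p>2$. For every $f\in\mathcal{L}_{q,1,\nu}\cap\mathcal{L}_{q,p,\nu}$ one has $\|\mathcal{F}_{q,\nu}f\|_{q,2,\nu}=\|f\|_{q,2,\nu}$.
   Context: $\mathbb{R}_q^+=\{q^n: n\in\mathbb{Z}\}$. For $a\in\mathbb{C}$, $(a;q^2)_n=\prod_{k=0}^{n-1}(1-aq^{2k})$ and $(a;q^2)_\infty=\prod_{k\ge 0}(1-aq^{2k})$. Jackson integral: $\int_0^\infty f(t)\,d_qt=(1-q)\sum_{n\in\mathbb{Z}}q^nf(q^n)$. For $1\le p<\infty$, $\mathcal{L}_{q,p,\nu}$ is the space of functions $f:\mathbb{R}_q^+\to\mathbb{R}$ with $\|f\|_{q,p,\nu}=\left(\int_0^\infty|f(x)|^px^{2\nu+1}d_qx\right)^{1/p}<\infty$. Normalized $q$-Bessel function: $j_\nu(x,q^2)=\sum_{n=0}^\infty(-1)^n\frac{q^{n(n+1)}}{(q^{2\nu+2};q^2)_n(q^2;q^2)_n}x^{2n}$. Put $c_{q,\nu}=\frac{1}{1-q}\frac{(q^{2\nu+2};q^2)_\infty}{(q^2;q^2)_\infty}$. The $q$-Bessel Fourier transform is $\mathcal{F}_{q,\nu}f(x)=c_{q,\nu}\int_0^\infty f(t)j_\nu(xt,q^2)t^{2\nu+1}d_qt$, $x\in\mathbb{R}_q^+$. *)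

theory Defs
  imports "HOL-Analysis.Analysis"
begin

text \<open>The \<open>q\<close>-shifted factorials \<open>(a;r)\<^sub>n\<close> and \<open>(a;r)\<^sub>\<infinity>\<close>; below the base is always \<open>r = q\<^sup>2\<close>.\<close>

definition qpoch :: "'a::real_normed_field \<Rightarrow> 'a \<Rightarrow> nat \<Rightarrow> 'a" where
  "qpoch a r n = (\<Prod>k<n. 1 - a * r ^ k)"

definition qpoch_inf :: "'a::real_normed_field \<Rightarrow> 'a \<Rightarrow> 'a" where
  "qpoch_inf a r = (\<Prod>k. 1 - a * r ^ k)"

text \<open>
  A function on \<open>{q\<^sup>n | n \<in> \<int>}\<close> is represented by a total function on the reals;
  everything below depends only on its values at the points \<open>q powi n\<close>.
  The bilateral Jackson series are understood as absolutely convergent sums over the integers.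
\<close>

definition jackson_integrable :: "real \<Rightarrow> (real \<Rightarrow> real) \<Rightarrow> bool" where
  "jackson_integrable q f \<longleftrightarrow> (\<lambda>n::int. q powi n * f (q powi n)) summable_on UNIV"

definition jackson_integral :: "real \<Rightarrow> (real \<Rightarrow> real) \<Rightarrow> real" where
  "jackson_integral q f = (1 - q) * (\<Sum>\<^sub>\<infinity>n::int. q powi n * f (q powi n))"

text \<open>The norm takes the value \<open>\<infinity>\<close> exactly when the defining series of nonnegative terms diverges.\<close>

definition qnorm :: "real \<Rightarrow> real \<Rightarrow> real \<Rightarrow> (real \<Rightarrow> real) \<Rightarrow> ennreal" where
  "qnorm q p \<nu> f =
     (let g = (\<lambda>x. \<bar>f x\<bar> powr p * x powr (2 * \<nu> + 1))
      in if jackson_integrable q g then ennreal (jackson_integral q g powr (1 / p)) else \<infinity>)"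

definition qLp :: "real \<Rightarrow> real \<Rightarrow> real \<Rightarrow> (real \<Rightarrow> real) set" where
  "qLp q p \<nu> = {f. qnorm q p \<nu> f < \<infinity>}"

text \<open>\<open>qbessel q \<nu> x\<close> is the normalized function \<open>j\<^sub>\<nu>(x, q\<^sup>2)\<close>.\<close>

definition qbessel :: "real \<Rightarrow> real \<Rightarrow> real \<Rightarrow> real" where
  "qbessel q \<nu> x =
     (\<Sum>n. (-1) ^ n * (q ^ (n * (n + 1)) / (qpoch (q powr (2 * \<nu> + 2)) (q\<^sup>2) n * qpoch (q\<^sup>2) (q\<^sup>2) n))
            * x ^ (2 * n))"

definition qbessel_const :: "real \<Rightarrow> real \<Rightarrow> real" where
  "qbessel_const q \<nu> =
     1 / (1 - q) * (qpoch_inf (q powr (2 * \<nu> + 2)) (q\<^sup>2) / qpoch_inf (q\<^sup>2) (q\<^sup>2))"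

definition qbessel_fourier :: "real \<Rightarrow> real \<Rightarrow> (real \<Rightarrow> real) \<Rightarrow> real \<Rightarrow> real" where
  "qbessel_fourier q \<nu> f x =
     qbessel_const q \<nu> * jackson_integral q (\<lambda>t. f t * qbessel q \<nu> (x * t) * t powr (2 * \<nu> + 1))"

end

theory Submission
  imports Defs
begin

text \<open>
  With \<open>s = q\<^sup>\<nu>\<^sup>+\<^sup>1\<close> and \<open>u n = f(q\<^sup>n) s\<^sup>n\<close> the transform becomes the Hankel operator
  \<open>u \<mapsto> (\<lambda>n. \<Sum>m. h(n + m) u m)\<close> on \<open>\<ell>\<^sup>2(\<int>)\<close>, where \<open>h k\<close> is a multiple of \<open>s\<^sup>k j\<^sub>\<nu>(q\<^sup>k, q\<^sup>2)\<close>.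
  Euler's expansion of \<open>(x; q\<^sup>2)\<^sub>\<infinity>\<close> and an exchange of summations show that \<open>h\<close> is the coefficient
  sequence of \<open>(s / x; q\<^sup>2)\<^sub>\<infinity> / (s x; q\<^sup>2)\<^sub>\<infinity>\<close>, which is unimodular on the unit circle.  So \<open>h\<close> is
  summable with autocorrelation \<open>\<delta>\<close>, and the Hankel operator is an isometry.  Functions in
  \<open>L\<^sup>1 \<inter> L\<^sup>p\<close> lie in \<open>L\<^sup>2\<close> because \<open>y\<^sup>2 \<le> y + y\<^sup>p\<close>.
\<close>

subsection \<open>Convolutions and Hankel operators on the integers\<close>

lemma summable_on_mult_Times:
  fixes f :: "'a \<Rightarrow> real" and g :: "'b \<Rightarrow> real"
  assumes "f summable_on A" "g summable_on B"
  shows "(\<lambda>(x, y). f x * g y) summable_on A \<times> B"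
proof -
  have "(\<lambda>x. \<bar>f x\<bar>) summable_on A" "(\<lambda>y. \<bar>g y\<bar>) summable_on B"
    using assms by (simp_all flip: real_norm_def summable_on_iff_abs_summable_on_real)
  then have "(\<lambda>z. norm (case z of (x, y) \<Rightarrow> f x * g y)) summable_on A \<times> B"
    unfolding Infinite_Sum.abs_summable_on_Sigma_iff
    by (auto simp: abs_mult infsum_cmult_right' intro!: summable_on_cmult_right summable_on_cmult_left)
  then show ?thesis by (rule Infinite_Sum.abs_summable_summable)
qed

lemma infsum_mult_Times:
  fixes f :: "'a \<Rightarrow> real" and g :: "'b \<Rightarrow> real"
  assumes "f summable_on A" "g summable_on B"
  shows "(\<Sum>\<^sub>\<infinity>(x, y)\<in>A \<times> B. f x * g y) = infsum f A * infsum g B"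
  using infsum_Sigma'_banach[of "\<lambda>x y. f x * g y" A "\<lambda>_. B"] summable_on_mult_Times[OF assms]
  by (simp add: infsum_cmult_right' infsum_cmult_left')

lemma summable_on_real_comparison:
  fixes f g :: "'a \<Rightarrow> real"
  assumes "g summable_on A" "\<And>x. x \<in> A \<Longrightarrow> \<bar>f x\<bar> \<le> g x"
  shows "f summable_on A"
  by (rule Infinite_Sum.abs_summable_summable, rule Infinite_Sum.abs_summable_on_comparison_test'[OF assms(1)])
    (use assms(2) in simp)

lemma summable_on_abs:
  fixes f :: "'a \<Rightarrow> real"
  assumes "f summable_on A"
  shows "(\<lambda>x. \<bar>f x\<bar>) summable_on A"
  using assms by (simp flip: real_norm_def summable_on_iff_abs_summable_on_real)

lemma summable_on_imp_bounded:
  fixes f :: "'a \<Rightarrow> real"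
  assumes "f summable_on UNIV"
  obtains M where "\<And>x. \<bar>f x\<bar> \<le> M"
proof
  fix x
  have "(\<Sum>\<^sub>\<infinity>y\<in>{x}. \<bar>f y\<bar>) \<le> (\<Sum>\<^sub>\<infinity>y. \<bar>f y\<bar>)"
    using summable_on_abs[OF assms] by (intro infsum_mono_neutral) auto
  then show "\<bar>f x\<bar> \<le> (\<Sum>\<^sub>\<infinity>y. \<bar>f y\<bar>)" by simp
qed

text \<open>This is the coefficient of \<open>x^k\<close> in \<open>B(1/x) A(x)\<close>, where
  \<open>A\<close> and \<open>B\<close> are the Laurent series with coefficients
  \<open>\<alpha>\<close> and \<open>\<beta>\<close>.\<close>

definition correlation :: "(int \<Rightarrow> real) \<Rightarrow> (int \<Rightarrow> real) \<Rightarrow> int \<Rightarrow> real" where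
  "correlation \<beta> \<alpha> k = (\<Sum>\<^sub>\<infinity>n. \<beta> n * \<alpha> (n + k))"

lemma summable_on_mult_shift:
  fixes \<alpha> \<beta> :: "int \<Rightarrow> real"
  assumes "\<alpha> summable_on UNIV" "\<beta> summable_on UNIV"
  shows "(\<lambda>(k, n). \<beta> n * \<alpha> (n + k)) summable_on UNIV \<times> UNIV"
proof -
  have "(\<lambda>(i, n). \<alpha> i * \<beta> n) summable_on UNIV \<times> UNIV"
    using assms by (rule summable_on_mult_Times)
  moreover have "bij_betw (\<lambda>(k, n). (n + k, n)) (UNIV \<times> UNIV :: (int \<times> int) set) (UNIV \<times> UNIV)"
    by (rule bij_betwI[where g = "\<lambda>(i, n). (i - n, n)"]) auto
  from summable_on_reindex_bij_betw[OF this, of "\<lambda>(i, n). \<alpha> i * \<beta> n"]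
  have "(\<lambda>(k, n). \<beta> n * \<alpha> (n + k)) summable_on UNIV \<times> UNIV \<longleftrightarrow>
    (\<lambda>(i, n). \<alpha> i * \<beta> n) summable_on UNIV \<times> UNIV"
    by (simp add: case_prod_unfold mult.commute)
  ultimately show ?thesis by simp
qed

lemma summable_on_correlation:
  assumes "\<alpha> summable_on UNIV" "\<beta> summable_on UNIV"
  shows "correlation \<beta> \<alpha> summable_on UNIV"
  unfolding correlation_def[abs_def]
  using summable_on_mult_shift[OF assms] by (rule summable_on_Sigma_banach)

text \<open>The substitution \<open>p = k + n + n'\<close> turns the autocorrelation into a product of two
  convolutions of \<open>\<alpha>\<close> and \<open>\<beta>\<close>.\<close>

lemma correlation_orthogonal:
  assumes \<alpha>: "\<alpha> summable_on UNIV" and \<beta>: "\<beta> summable_on UNIV"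
    and conv: "\<And>p. (\<Sum>\<^sub>\<infinity>n. \<beta> n * \<alpha> (p - n)) = (if p = 0 then 1 else 0)"
  shows "(\<Sum>\<^sub>\<infinity>k. correlation \<beta> \<alpha> k * correlation \<beta> \<alpha> (k + d)) = (if d = 0 then 1 else 0)"
proof -
  obtain M where M: "\<And>x. \<bar>\<alpha> x\<bar> \<le> M"
    using summable_on_imp_bounded[OF \<alpha>] by blast
  have s1: "(\<lambda>n. \<beta> n * \<alpha> (n + k)) summable_on UNIV" for k
    by (rule summable_on_real_comparison[OF summable_on_cmult_left[OF summable_on_abs[OF \<beta>], of M]])
       (auto simp: abs_mult intro!: mult_mono M)
  have s2: "(\<lambda>n. \<beta> n * \<alpha> (k - n)) summable_on UNIV" for k
    by (rule summable_on_real_comparison[OF summable_on_cmult_left[OF summable_on_abs[OF \<beta>], of M]])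
       (auto simp: abs_mult intro!: mult_mono M)
  define T where "T = (\<lambda>(k, n, n'). (\<beta> n * \<alpha> (n + k)) * (\<beta> n' * \<alpha> (n' + (k + d))))"
  have bij: "bij_betw (\<lambda>(k, n, n'). (n + k, n, n')) (UNIV :: (int \<times> int \<times> int) set) UNIV"
    by (rule bij_betwI[where g = "\<lambda>(i, n, n'). (i - n, n, n')"]) auto
  have "(\<lambda>(i, n, n'). \<bar>\<alpha> i\<bar> * (\<bar>\<beta> n\<bar> * \<bar>\<beta> n'\<bar>)) summable_on UNIV \<times> UNIV \<times> UNIV"
    using summable_on_mult_Times[OF summable_on_abs[OF \<alpha>]
      summable_on_mult_Times[OF summable_on_abs[OF \<beta>] summable_on_abs[OF \<beta>]]]
    by (simp add: case_prod_unfold)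
  then have "(\<lambda>(k, n, n'). \<bar>\<alpha> (n + k)\<bar> * (\<bar>\<beta> n\<bar> * \<bar>\<beta> n'\<bar>)) summable_on UNIV"
    using summable_on_reindex_bij_betw[OF bij, of "\<lambda>(i, n, n'). \<bar>\<alpha> i\<bar> * (\<bar>\<beta> n\<bar> * \<bar>\<beta> n'\<bar>)"]
    by (simp add: case_prod_unfold)
  \<comment> \<open>Bounding the second \<open>\<alpha>\<close> factor by \<open>M\<close> leaves
    three factors in independent indices, which already form a summable family.\<close>
  from summable_on_cmult_left[OF this, of M] have T: "T summable_on UNIV \<times> UNIV \<times> UNIV"
  proof (simp, elim summable_on_real_comparison)
    fix x :: "int \<times> int \<times> int"
    obtain k n n' where x: "x = (k, n, n')" by (cases x) auto
    show "\<bar>T x\<bar> \<le> (case x of (k, n, n') \<Rightarrow> \<bar>\<alpha> (n + k)\<bar> * (\<bar>\<beta> n\<bar> * \<bar>\<beta> n'\<bar>)) * M"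
      using mult_left_mono[OF M[of "n' + (k + d)"], of "\<bar>\<alpha> (n + k)\<bar> * (\<bar>\<beta> n\<bar> * \<bar>\<beta> n'\<bar>)"]
      by (simp add: x T_def abs_mult mult_ac)
  qed
  \<comment> \<open>With \<open>k = p - n - n'\<close> the arguments \<open>n + k\<close> and
    \<open>n' + k + d\<close> become \<open>p - n'\<close> and \<open>p + d - n\<close>. Each
    \<open>\<beta>\<close> is thus paired with the \<open>\<alpha>\<close> of the other factor, and
    both sums are convolutions.\<close>
  have bij': "bij_betw (\<lambda>(p, n, n'). (p - n - n', n, n'))
      (UNIV \<times> UNIV \<times> UNIV :: (int \<times> int \<times> int) set) (UNIV \<times> UNIV \<times> UNIV)"
    by (rule bij_betwI[where g = "\<lambda>(k, n, n'). (k + n + n', n, n')"]) auto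
  have "(\<Sum>\<^sub>\<infinity>k. correlation \<beta> \<alpha> k * correlation \<beta> \<alpha> (k + d))
     = (\<Sum>\<^sub>\<infinity>k. \<Sum>\<^sub>\<infinity>z\<in>UNIV \<times> UNIV. T (k, z))"
    unfolding correlation_def T_def
    using infsum_mult_Times[OF s1 s1] by (simp add: case_prod_unfold)
  also have "\<dots> = infsum T (UNIV \<times> UNIV \<times> UNIV)"
    using T by (rule infsum_Sigma_banach)
  also have "\<dots> = (\<Sum>\<^sub>\<infinity>x\<in>UNIV \<times> UNIV \<times> UNIV. T (case x of (p, n, n') \<Rightarrow> (p - n - n', n, n')))"
    by (rule infsum_reindex_bij_betw[OF bij', symmetric])
  also have "\<dots> = (\<Sum>\<^sub>\<infinity>p. \<Sum>\<^sub>\<infinity>z\<in>UNIV \<times> UNIV. T (case z of (n, n') \<Rightarrow> (p - n - n', n, n')))"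
    using T summable_on_reindex_bij_betw[OF bij', of T]
      infsum_Sigma_banach[of "\<lambda>x. T (case x of (p, n, n') \<Rightarrow> (p - n - n', n, n'))" UNIV "\<lambda>_. UNIV \<times> UNIV"]
    by (simp add: case_prod_unfold)
  also have "\<dots> = (\<Sum>\<^sub>\<infinity>p. (if p + d = 0 then 1 else 0) * (if p = 0 then 1 else 0))"
  proof (rule infsum_cong)
    fix p :: int
    have "(\<Sum>\<^sub>\<infinity>z\<in>UNIV \<times> UNIV. T (case z of (n, n') \<Rightarrow> (p - n - n', n, n')))
        = (\<Sum>\<^sub>\<infinity>(n, n')\<in>UNIV \<times> UNIV. (\<beta> n * \<alpha> ((p + d) - n)) * (\<beta> n' * \<alpha> (p - n')))"
      by (rule infsum_cong) (auto simp: T_def algebra_simps)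
    also have "\<dots> = (if p + d = 0 then 1 else 0) * (if p = 0 then 1 else 0)"
      unfolding infsum_mult_Times[OF s2 s2] conv ..
    finally show "(\<Sum>\<^sub>\<infinity>z\<in>UNIV \<times> UNIV. T (case z of (n, n') \<Rightarrow> (p - n - n', n, n')))
       = (if p + d = 0 then 1 else 0) * (if p = 0 then 1 else 0)" .
  qed
  also have "\<dots> = (\<Sum>\<^sub>\<infinity>p\<in>{0::int}. if d = 0 then 1 else 0)"
    by (rule infsum_cong_neutral) auto
  finally show ?thesis by simp
qed

text \<open>Expanding the square gives a triple sum over \<open>n, m, l\<close>; summing over
  \<open>n\<close> first, orthogonality of the shifts of \<open>h\<close> leaves only the diagonal
  \<open>l = m\<close>. The form \<open>has_sum\<close> also records convergence, on which
  finiteness of \<open>qnorm\<close> depends.\<close>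

lemma hankel_isometry:
  fixes h u :: "int \<Rightarrow> real"
  assumes h: "h summable_on UNIV"
    and orth: "\<And>d. (\<Sum>\<^sub>\<infinity>k. h k * h (k + d)) = (if d = 0 then 1 else 0)"
    and u: "(\<lambda>n. (u n)\<^sup>2) summable_on UNIV"
  shows "((\<lambda>n. (\<Sum>\<^sub>\<infinity>m. h (n + m) * u m)\<^sup>2) has_sum (\<Sum>\<^sub>\<infinity>n. (u n)\<^sup>2)) UNIV"
proof -
  obtain M0 where "\<And>n. \<bar>(u n)\<^sup>2\<bar> \<le> M0"
    using summable_on_imp_bounded[OF u] by blast
  then have M: "\<bar>u n\<bar> \<le> sqrt M0" for n
    using real_sqrt_le_mono[of "(u n)\<^sup>2" M0] by simp
  have s: "(\<lambda>m. h (n + m) * u m) summable_on UNIV" for n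
  proof (rule summable_on_real_comparison)
    have "(\<lambda>m. h (n + m)) summable_on UNIV"
      using h summable_on_reindex_bij_betw[OF bij_plus[of n], of h] by simp
    then show "(\<lambda>m. \<bar>h (n + m)\<bar> * sqrt M0) summable_on UNIV"
      by (intro summable_on_cmult_left summable_on_abs)
  qed (auto simp: abs_mult intro!: mult_mono M)
  define T where "T = (\<lambda>(n, m, l). (h (n + m) * u m) * (h (n + l) * u l))"
  have B: "(\<lambda>(i, j, m). \<bar>h i\<bar> * (\<bar>h j\<bar> * (u m)\<^sup>2)) summable_on UNIV \<times> UNIV \<times> UNIV"
    using summable_on_mult_Times[OF summable_on_abs[OF h] summable_on_mult_Times[OF summable_on_abs[OF h] u]]
    by (simp add: case_prod_unfold)
  \<comment> \<open>The bound
    \<open>\<bar>u m * u l\<bar> \<le> (u m)\<^sup>2 + (u l)\<^sup>2\<close> splits the majorant in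
    two. In each half, \<open>n + m\<close>, \<open>n + l\<close> and the index of the surviving
    \<open>u\<close> are independent coordinates.\<close>
  have bij1: "bij_betw (\<lambda>(n, m, l). (n + m, n + l, m)) (UNIV :: (int \<times> int \<times> int) set) UNIV"
    by (rule bij_betwI[where g = "\<lambda>(i, j, m). (i - m, m, j + m - i)"]) auto
  have bij2: "bij_betw (\<lambda>(n, m, l). (n + m, n + l, l)) (UNIV :: (int \<times> int \<times> int) set) UNIV"
    by (rule bij_betwI[where g = "\<lambda>(i, j, l). (j - l, i + l - j, l)"]) auto
  have "(\<lambda>(n, m, l). \<bar>h (n + m)\<bar> * (\<bar>h (n + l)\<bar> * (u m)\<^sup>2)) summable_on UNIV"
    using B summable_on_reindex_bij_betw[OF bij1, of "\<lambda>(i, j, m). \<bar>h i\<bar> * (\<bar>h j\<bar> * (u m)\<^sup>2)"]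
    by (simp add: case_prod_unfold)
  moreover have "(\<lambda>(n, m, l). \<bar>h (n + m)\<bar> * (\<bar>h (n + l)\<bar> * (u l)\<^sup>2)) summable_on UNIV"
    using B summable_on_reindex_bij_betw[OF bij2, of "\<lambda>(i, j, m). \<bar>h i\<bar> * (\<bar>h j\<bar> * (u m)\<^sup>2)"]
    by (simp add: case_prod_unfold)
  ultimately have "T summable_on UNIV"
  proof (rule summable_on_real_comparison[OF summable_on_add])
    fix x :: "int \<times> int \<times> int"
    obtain n m l where x: "x = (n, m, l)" by (cases x) auto
    have "\<bar>u m\<bar> * \<bar>u l\<bar> \<le> (u m)\<^sup>2 + (u l)\<^sup>2"
      using sum_squares_bound[of "\<bar>u m\<bar>" "\<bar>u l\<bar>"] mult_nonneg_nonneg[OF abs_ge_zero[of "u m"] abs_ge_zero[of "u l"]]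
      unfolding power2_abs by linarith
    from mult_left_mono[OF this, of "\<bar>h (n + m)\<bar> * \<bar>h (n + l)\<bar>"]
    show "\<bar>T x\<bar> \<le> (case x of (n, m, l) \<Rightarrow> \<bar>h (n + m)\<bar> * (\<bar>h (n + l)\<bar> * (u m)\<^sup>2))
       + (case x of (n, m, l) \<Rightarrow> \<bar>h (n + m)\<bar> * (\<bar>h (n + l)\<bar> * (u l)\<^sup>2))"
      by (simp add: x T_def abs_mult algebra_simps)
  qed
  then have T: "T summable_on UNIV \<times> UNIV" by simp
  have sq: "(\<Sum>\<^sub>\<infinity>m. h (n + m) * u m)\<^sup>2 = (\<Sum>\<^sub>\<infinity>z. T (n, z))" for n
    using infsum_mult_Times[OF s[of n] s[of n]]
    by (simp add: T_def case_prod_unfold power2_eq_square)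
  have summ: "(\<lambda>n. (\<Sum>\<^sub>\<infinity>m. h (n + m) * u m)\<^sup>2) summable_on UNIV"
    unfolding sq using summable_on_Sigma_banach[of "\<lambda>n z. T (n, z)" UNIV "\<lambda>_. UNIV"] T by simp
  have "(\<Sum>\<^sub>\<infinity>n. (\<Sum>\<^sub>\<infinity>m. h (n + m) * u m)\<^sup>2) = (\<Sum>\<^sub>\<infinity>z. \<Sum>\<^sub>\<infinity>n. T (n, z))"
    unfolding sq using infsum_swap_banach[of "\<lambda>n z. T (n, z)" UNIV UNIV] T by simp
  also have "\<dots> = (\<Sum>\<^sub>\<infinity>(m, l). if l = m then (u m)\<^sup>2 else 0)"
  proof (rule infsum_cong)
    fix z :: "int \<times> int"
    obtain m l where z: "z = (m, l)" by (cases z) auto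
    have "(\<Sum>\<^sub>\<infinity>n. T (n, z)) = (\<Sum>\<^sub>\<infinity>n. h (n + m) * h (n + l) * (u m * u l))"
      by (simp add: T_def z mult_ac)
    also have "\<dots> = (\<Sum>\<^sub>\<infinity>n. h (n + m) * h ((n + m) + (l - m))) * (u m * u l)"
      by (simp add: infsum_cmult_left')
    also have "(\<Sum>\<^sub>\<infinity>n. h (n + m) * h ((n + m) + (l - m))) = (\<Sum>\<^sub>\<infinity>k. h k * h (k + (l - m)))"
      by (rule infsum_reindex_bij_betw[OF bij_plus_right, of "\<lambda>k. h k * h (k + (l - m))"])
    finally show "(\<Sum>\<^sub>\<infinity>n. T (n, z)) = (case z of (m, l) \<Rightarrow> if l = m then (u m)\<^sup>2 else 0)"
      by (simp add: z orth power2_eq_square)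
  qed
  also have "\<dots> = (\<Sum>\<^sub>\<infinity>(m, l)\<in>range (\<lambda>m. (m, m)). (u m)\<^sup>2)"
    by (rule infsum_cong_neutral) auto
  also have "\<dots> = (\<Sum>\<^sub>\<infinity>m. (u m)\<^sup>2)"
    using infsum_reindex[of "\<lambda>m. (m, m)" UNIV "\<lambda>(m, l). (u m)\<^sup>2"] by (simp add: inj_on_def o_def)
  finally show ?thesis
    using has_sum_infsum[OF summ] by (simp only:)
qed

subsection \<open>Euler's expansion of the infinite shifted factorial\<close>

text \<open>These are Euler's coefficients of \<open>(x; r)\<^sub>\<infinity>\<close> as a power
  series in \<open>x\<close>.\<close>

definition qexp_coeff :: "real \<Rightarrow> nat \<Rightarrow> real" where
  "qexp_coeff r n = (-1) ^ n * r ^ (n * (n - 1) div 2) / qpoch r r n"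

definition qexp :: "real \<Rightarrow> real \<Rightarrow> real" where
  "qexp r x = (\<Sum>n. qexp_coeff r n * x ^ n)"

text \<open>These are the coefficients of \<open>1 / (x; r)\<^sub>\<infinity>\<close>, extended by
  zero to negative indices so that convolutions run over all integers.\<close>

definition inv_qexp_coeff :: "real \<Rightarrow> int \<Rightarrow> real" where
  "inv_qexp_coeff r k = (if k < 0 then 0 else 1 / qpoch r r (nat k))"

lemma qpoch_0 [simp]: "qpoch a r 0 = 1"
  by (simp add: qpoch_def)

lemma qpoch_Suc: "qpoch a r (Suc n) = qpoch a r n * (1 - a * r ^ n)"
  by (simp add: qpoch_def)

lemma qpoch_nonzero:
  fixes a r :: real
  assumes "0 \<le> a" "a < 1" "0 < r" "r < 1"
  shows "qpoch a r n \<noteq> 0"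
proof -
  have "a * r ^ k < 1" for k
    using assms mult_left_le[of "r ^ k" a] power_le_one[of r k] by linarith
  then show ?thesis
    by (simp add: qpoch_def less_imp_neq[THEN not_sym])
qed

lemma qexp_coeff_0 [simp]: "qexp_coeff r 0 = 1"
  by (simp add: qexp_coeff_def)

context
  fixes r :: real
  assumes r: "0 < r" "r < 1"
begin

lemma qpoch_base_nonzero: "qpoch r r n \<noteq> 0"
  using r by (intro qpoch_nonzero) auto

text \<open>The exponent \<open>n(n-1)/2\<close> grows by \<open>n\<close>, and \<open>qpoch\<close>
  gains one factor. This recursion yields convergence, the functional equation and the inverse
  series below.\<close>

lemma qexp_coeff_Suc: "qexp_coeff r (Suc n) * (1 - r ^ Suc n) = - (r ^ n * qexp_coeff r n)"
proof -
  have "Suc n * n div 2 = n * (n - 1) div 2 + n"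
    by (cases n) (auto simp: algebra_simps)
  moreover have "1 - r ^ Suc n \<noteq> 0"
    using power_Suc_less_one[of r n] r by auto
  ultimately show ?thesis
    using qpoch_base_nonzero[of n]
    by (simp add: qexp_coeff_def qpoch_Suc power_add field_simps)
qed

text \<open>The ratio of consecutive terms is at most \<open>r^n \<bar>x\<bar> / (1 - r)\<close> in
  absolute value, which tends to zero for every \<open>x\<close>.\<close>

lemma summable_norm_qexp: "summable (\<lambda>n. norm (qexp_coeff r n * x ^ n))"
proof -
  have "(\<lambda>n. r ^ n * (\<bar>x\<bar> / (1 - r))) \<longlonglongrightarrow> 0 * (\<bar>x\<bar> / (1 - r))"
    using r by (intro tendsto_intros LIMSEQ_power_zero) auto
  then have "\<forall>\<^sub>F n in sequentially. r ^ n * (\<bar>x\<bar> / (1 - r)) < 1 / 2"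
    by (intro order_tendstoD(2)[where y = 0]) auto
  then obtain N where N: "\<And>n. n \<ge> N \<Longrightarrow> r ^ n * (\<bar>x\<bar> / (1 - r)) < 1 / 2"
    by (auto simp: eventually_sequentially)
  have "norm (norm (qexp_coeff r (Suc n) * x ^ Suc n))
      \<le> 1 / 2 * norm (norm (qexp_coeff r n * x ^ n))" if "n \<ge> N" for n
  proof -
    have d: "1 - r \<le> 1 - r ^ Suc n"
      using r power_decreasing[of 1 "Suc n" r] by auto
    have "qexp_coeff r (Suc n) = - (r ^ n * qexp_coeff r n) / (1 - r ^ Suc n)"
      using qexp_coeff_Suc[of n] d r by (metis diff_gt_0_iff_gt less_le_not_le nonzero_eq_divide_eq)
    then have "\<bar>qexp_coeff r (Suc n)\<bar> = r ^ n * \<bar>qexp_coeff r n\<bar> / (1 - r ^ Suc n)"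
      using d r by (simp add: abs_mult del: power_Suc)
    also have "\<dots> \<le> r ^ n * \<bar>qexp_coeff r n\<bar> / (1 - r)"
      using d r by (intro divide_left_mono mult_pos_pos mult_nonneg_nonneg) (auto simp del: power_Suc)
    finally have "\<bar>qexp_coeff r (Suc n)\<bar> * \<bar>x\<bar> ^ Suc n
        \<le> r ^ n * \<bar>qexp_coeff r n\<bar> / (1 - r) * \<bar>x\<bar> ^ Suc n"
      by (intro mult_right_mono) auto
    also have "\<dots> = r ^ n * (\<bar>x\<bar> / (1 - r)) * (\<bar>qexp_coeff r n\<bar> * \<bar>x\<bar> ^ n)"
      by simp
    also have "\<dots> \<le> 1 / 2 * (\<bar>qexp_coeff r n\<bar> * \<bar>x\<bar> ^ n)"
      using N[OF that] by (intro mult_right_mono) auto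
    finally show ?thesis
      by (simp add: abs_mult power_abs)
  qed
  then show ?thesis
    by (intro summable_ratio_test[of "1 / 2" N]) auto
qed

lemma sums_qexp: "(\<lambda>n. qexp_coeff r n * x ^ n) sums qexp r x"
  unfolding qexp_def using summable_norm_cancel[OF summable_norm_qexp] by (rule summable_sums)

lemma has_sum_qexp: "((\<lambda>n. qexp_coeff r n * x ^ n) has_sum qexp r x) UNIV"
  using summable_norm_qexp sums_qexp by (rule norm_summable_imp_has_sum)

lemma qexp_0 [simp]: "qexp r 0 = 1"
  using sums_unique2[OF sums_qexp powser_sums_zero[of "qexp_coeff r"]] by simp

text \<open>By the coefficient recursion, \<open>x * qexp r (r * x)\<close> and
  \<open>qexp r (r * x) - qexp r x\<close> have the same power series.\<close>

lemma qexp_rec: "qexp r x = (1 - x) * qexp r (r * x)"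
proof -
  let ?e = "\<lambda>n. qexp_coeff r n * (r * x) ^ n"
  have "(\<lambda>n. x * ?e n) sums (x * qexp r (r * x))"
    by (intro sums_mult sums_qexp)
  moreover have "x * ?e n = qexp_coeff r (Suc n) * (r * x) ^ Suc n - qexp_coeff r (Suc n) * x ^ Suc n" for n
  proof -
    have "qexp_coeff r (Suc n) * (r * x) ^ Suc n - qexp_coeff r (Suc n) * x ^ Suc n
        = - (qexp_coeff r (Suc n) * (1 - r ^ Suc n)) * x ^ Suc n"
      by (simp add: power_mult_distrib algebra_simps)
    also have "\<dots> = x * ?e n"
      unfolding qexp_coeff_Suc by (simp add: power_mult_distrib)
    finally show ?thesis by simp
  qed
  ultimately have "(\<lambda>n. qexp_coeff r (Suc n) * (r * x) ^ Suc n - qexp_coeff r (Suc n) * x ^ Suc n)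
      sums (x * qexp r (r * x))"
    by simp
  \<comment> \<open>The constant terms cancel, so undoing the index shift does not change the
    sum.\<close>
  then have "(\<lambda>n. qexp_coeff r n * (r * x) ^ n - qexp_coeff r n * x ^ n) sums (x * qexp r (r * x))"
    by (subst (asm) sums_Suc_iff) simp
  from sums_unique2[OF this sums_diff[OF sums_qexp sums_qexp]]
  show ?thesis by (simp add: algebra_simps)
qed

lemma qexp_eq_qpoch_mult: "qexp r x = qpoch x r n * qexp r (x * r ^ n)"
proof (induction n)
  case (Suc n)
  then show ?case
    using qexp_rec[of "x * r ^ n"] by (simp add: qpoch_Suc mult_ac)
qed simp

text \<open>In \<open>qexp r x = qpoch x r n * qexp r (x * r ^ n)\<close> the last factor tends to
  \<open>qexp r 0 = 1\<close> by continuity. A zero at \<open>x\<close> in \<open>[0, 1)\<close>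
  would force zeros at all \<open>x * r ^ n\<close>, against this limit.\<close>

lemma qpoch_tendsto_qexp: "(\<lambda>n. qpoch x r n) \<longlonglongrightarrow> qexp r x"
  and qexp_nonzero: "0 \<le> x \<Longrightarrow> x < 1 \<Longrightarrow> qexp r x \<noteq> 0"
proof -
  have "isCont (qexp r) 0"
    unfolding qexp_def[abs_def]
    using summable_norm_cancel[OF summable_norm_qexp] by (rule isCont_powser_converges_everywhere)
  moreover have "(\<lambda>n. x * r ^ n) \<longlonglongrightarrow> x * 0"
    using r by (intro tendsto_intros LIMSEQ_power_zero) auto
  ultimately have lim: "(\<lambda>n. qexp r (x * r ^ n)) \<longlonglongrightarrow> 1"
    using isCont_tendsto_compose[of 0 "qexp r"] by fastforce
  have "(\<lambda>n. qexp r x / qexp r (x * r ^ n)) \<longlonglongrightarrow> qexp r x / 1"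
    using lim by (intro tendsto_intros) auto
  moreover have "\<forall>\<^sub>F n in sequentially. qexp r (x * r ^ n) \<noteq> 0"
    using lim by (rule tendsto_imp_eventually_ne) simp
  then have "\<forall>\<^sub>F n in sequentially. qexp r x / qexp r (x * r ^ n) = qpoch x r n"
    by eventually_elim (metis nonzero_eq_divide_eq qexp_eq_qpoch_mult)
  ultimately show "(\<lambda>n. qpoch x r n) \<longlonglongrightarrow> qexp r x"
    using tendsto_cong by fastforce
  show "qexp r x \<noteq> 0" if "0 \<le> x" "x < 1"
  proof
    assume "qexp r x = 0"
    then have "qexp r (x * r ^ n) = 0" for n
      using qexp_eq_qpoch_mult[of x n] qpoch_nonzero[OF that r] by auto
    with lim show False by (simp add: LIMSEQ_const_iff)
  qed
qed

lemma qpoch_inf_eq_qexp: "0 \<le> x \<Longrightarrow> x < 1 \<Longrightarrow> qpoch_inf x r = qexp r x"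
  unfolding qpoch_inf_def
  using qpoch_tendsto_qexp[of x] qexp_nonzero[of x]
  by (intro prodinf_eq_prod_lim') (auto simp: qpoch_def)

text \<open>The factor \<open>1 - x\<close> vanishes at \<open>x = 1\<close>, and the functional
  equation carries this zero to all \<open>r^(-n)\<close>.\<close>

lemma qexp_neg_power: "qexp r (inverse r ^ n) = 0"
proof (induction n)
  case 0
  then show ?case using qexp_rec[of 1] by simp
next
  case (Suc n)
  moreover have "r * inverse r ^ Suc n = inverse r ^ n"
    using r by simp
  ultimately show ?case
    using qexp_rec[of "inverse r ^ Suc n"] by (simp only: mult_zero_right)
qed

text \<open>For \<open>k \<ge> 0\<close> this is
  \<open>(r; r)\<^sub>\<infinity> / (r; r)\<^sub>k\<close>. For \<open>k < 0\<close> the zeros of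
  \<open>qexp\<close> match the default value of \<open>inv_qexp_coeff\<close>.\<close>

lemma qexp_powi: "qexp r (r powi (k + 1)) = qexp r r * inv_qexp_coeff r k"
proof (cases "k < 0")
  case True
  then have "r powi (k + 1) = inverse r ^ nat (- k - 1)"
    by (auto simp: power_int_def power_inverse)
  with True show ?thesis
    by (simp add: qexp_neg_power inv_qexp_coeff_def)
next
  case False
  then have "r powi (k + 1) = r * r ^ nat k"
    by (simp add: power_int_def nat_add_distrib)
  with False show ?thesis
    using qexp_eq_qpoch_mult[of r "nat k"] qpoch_base_nonzero[of "nat k"]
    by (simp add: inv_qexp_coeff_def)
qed

text \<open>This is the coefficient form of the statement that the two series are inverse to each
  other. Multiplied by \<open>1 - r^n\<close> for \<open>n > 0\<close>, the sum splits by the two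
  coefficient recursions into opposite halves.\<close>

lemma sum_qexp_coeff_qpoch:
  "(\<Sum>j\<le>n. qexp_coeff r j / qpoch r r (n - j)) = (if n = 0 then 1 else 0)"
proof (cases n)
  case (Suc m)
  let ?a = "\<lambda>j. 1 / qpoch r r j"
  have a: "(1 - r ^ Suc j) * ?a (Suc j) = ?a j" for j
    using power_Suc_less_one[of r j] r qpoch_base_nonzero[of j]
    by (simp add: qpoch_Suc field_simps)
  \<comment> \<open>Used with \<open>y = r^j\<close> and \<open>z = r^(n - j)\<close>, so that each
    half carries the factor required by one recursion.\<close>
  have distr: "(1 - y * z) * (e * b) = (1 - y) * e * b + y * e * ((1 - z) * b)" for y z e b :: real
    by (simp add: algebra_simps)
  have "(1 - r ^ Suc m) * (\<Sum>j\<le>Suc m. qexp_coeff r j * ?a (Suc m - j))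
      = (\<Sum>j\<le>Suc m. (1 - r ^ j) * qexp_coeff r j * ?a (Suc m - j)
                  + r ^ j * qexp_coeff r j * ((1 - r ^ (Suc m - j)) * ?a (Suc m - j)))"
    unfolding sum_distrib_left
  proof (rule sum.cong)
    fix j assume "j \<in> {..Suc m}"
    then have split: "r ^ Suc m = r ^ j * r ^ (Suc m - j)"
      by (simp flip: power_add)
    show "(1 - r ^ Suc m) * (qexp_coeff r j * ?a (Suc m - j))
       = (1 - r ^ j) * qexp_coeff r j * ?a (Suc m - j)
                  + r ^ j * qexp_coeff r j * ((1 - r ^ (Suc m - j)) * ?a (Suc m - j))"
      unfolding split by (rule distr)
  qed simp
  also have "\<dots> = (\<Sum>j\<le>Suc m. (1 - r ^ j) * qexp_coeff r j * ?a (Suc m - j))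
      + (\<Sum>j\<le>Suc m. r ^ j * qexp_coeff r j * ((1 - r ^ (Suc m - j)) * ?a (Suc m - j)))"
    by (rule sum.distrib)
  also have "(\<Sum>j\<le>Suc m. (1 - r ^ j) * qexp_coeff r j * ?a (Suc m - j))
     = (\<Sum>j\<le>m. (qexp_coeff r (Suc j) * (1 - r ^ Suc j)) * ?a (m - j))"
    by (subst sum.atMost_Suc_shift) (simp add: mult_ac)
  also have "\<dots> = - (\<Sum>j\<le>m. r ^ j * qexp_coeff r j * ?a (m - j))"
    by (simp only: qexp_coeff_Suc) (simp add: sum_negf)
  also have "(\<Sum>j\<le>Suc m. r ^ j * qexp_coeff r j * ((1 - r ^ (Suc m - j)) * ?a (Suc m - j)))
     = (\<Sum>j\<le>m. r ^ j * qexp_coeff r j * ((1 - r ^ (Suc m - j)) * ?a (Suc m - j)))"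
    by simp
  also have "\<dots> = (\<Sum>j\<le>m. r ^ j * qexp_coeff r j * ?a (m - j))"
    by (intro sum.cong refl) (simp only: Suc_diff_le atMost_iff a)
  finally have "(1 - r ^ Suc m) * (\<Sum>j\<le>Suc m. qexp_coeff r j * ?a (Suc m - j)) = 0"
    by simp
  moreover have "1 - r ^ Suc m \<noteq> 0"
    using power_Suc_less_one[of r m] r by auto
  ultimately show ?thesis
    using Suc by simp
qed simp

end

subsection \<open>The kernel of the transform\<close>

lemma infsum_int_nonneg:
  fixes g :: "nat \<Rightarrow> real"
  shows "(\<Sum>\<^sub>\<infinity>k::int. if k < 0 then 0 else g (nat k)) = (\<Sum>\<^sub>\<infinity>n. g n)"
proof -
  have "(\<Sum>\<^sub>\<infinity>k::int. if k < 0 then 0 else g (nat k)) = (\<Sum>\<^sub>\<infinity>k\<in>range int. g (nat k))"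
    by (rule infsum_cong_neutral) (auto simp: image_iff not_less dest: zero_le_imp_eq_int)
  also have "\<dots> = (\<Sum>\<^sub>\<infinity>n. g n)"
    by (subst infsum_reindex) (auto simp: o_def)
  finally show ?thesis .
qed

lemma summable_on_int_nonneg:
  fixes g :: "nat \<Rightarrow> real"
  assumes "g summable_on UNIV"
  shows "(\<lambda>k::int. if k < 0 then 0 else g (nat k)) summable_on UNIV"
proof -
  have "(\<lambda>k. g (nat k)) summable_on range int"
    using assms by (subst summable_on_reindex) (auto simp: o_def)
  also have "?this \<longleftrightarrow> ?thesis"
    by (rule summable_on_cong_neutral) (auto simp: image_iff not_less dest: zero_le_imp_eq_int)
  finally show ?thesis .
qed

section \<open>Series identities for
  \<open>(s / x; r)\<^sub>\<infinity> / (s x; r)\<^sub>\<infinity>\<close>\<close>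

context
  fixes r :: real
  assumes r: "0 < r" "r < 1"
begin

text \<open>Expanding \<open>qexp r (a * r ^ n)\<close> gives a double series that is symmetric in \<open>(a, z)\<close>.\<close>

lemma has_sum_qexp_exchange:
  "((\<lambda>n. qexp_coeff r n * z ^ n * qexp r (a * r ^ n)) has_sum
    (\<Sum>\<^sub>\<infinity>m. qexp_coeff r m * a ^ m * qexp r (z * r ^ m))) UNIV"
proof -
  define T where "T = (\<lambda>n m. (qexp_coeff r n * z ^ n) * (qexp_coeff r m * a ^ m) * r ^ (n * m))"
  have s: "(\<lambda>n. \<bar>qexp_coeff r n * x ^ n\<bar>) summable_on UNIV" for x
    using has_sum_qexp[OF r] by (intro summable_on_abs has_sum_imp_summable)
  have T: "(\<lambda>(n, m). T n m) summable_on UNIV \<times> UNIV"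
  proof (rule summable_on_real_comparison[OF summable_on_mult_Times[OF s[of z] s[of a]]])
    fix x :: "nat \<times> nat"
    obtain n m where x: "x = (n, m)" by (cases x) auto
    have "\<bar>T n m\<bar> = \<bar>qexp_coeff r n * z ^ n\<bar> * \<bar>qexp_coeff r m * a ^ m\<bar> * r ^ (n * m)"
      using r by (simp add: T_def abs_mult)
    also have "\<dots> \<le> \<bar>qexp_coeff r n * z ^ n\<bar> * \<bar>qexp_coeff r m * a ^ m\<bar>"
      using r by (intro mult_left_le power_le_one) auto
    finally show "\<bar>case x of (n, m) \<Rightarrow> T n m\<bar>
        \<le> (case x of (n, m) \<Rightarrow> \<bar>qexp_coeff r n * z ^ n\<bar> * \<bar>qexp_coeff r m * a ^ m\<bar>)"
      by (simp add: x)
  qed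
  have n: "(\<Sum>\<^sub>\<infinity>m. T n m) = qexp_coeff r n * z ^ n * qexp r (a * r ^ n)" for n
  proof -
    have "(\<Sum>\<^sub>\<infinity>m. T n m) = (\<Sum>\<^sub>\<infinity>m. qexp_coeff r n * z ^ n * (qexp_coeff r m * (a * r ^ n) ^ m))"
      by (simp add: T_def power_mult_distrib power_mult mult_ac)
    then show ?thesis
      by (simp only: infsum_cmult_right' infsumI[OF has_sum_qexp[OF r]])
  qed
  have m: "(\<Sum>\<^sub>\<infinity>n. T n m) = qexp_coeff r m * a ^ m * qexp r (z * r ^ m)" for m
  proof -
    have "(\<Sum>\<^sub>\<infinity>n. T n m) = (\<Sum>\<^sub>\<infinity>n. qexp_coeff r m * a ^ m * (qexp_coeff r n * (z * r ^ m) ^ n))"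
      by (simp add: T_def power_mult_distrib power_mult[symmetric] mult_ac)
    then show ?thesis
      by (simp only: infsum_cmult_right' infsumI[OF has_sum_qexp[OF r]])
  qed
  show ?thesis
    using has_sum_infsum[OF summable_on_Sigma_banach[OF T]] infsum_swap_banach[OF T]
    by (simp only: n m)
qed

text \<open>The coefficients \<open>1 / (r; r)\<^sub>n\<close> converge, hence are bounded, and a
  geometric series dominates.\<close>

lemma summable_on_inv_qexp:
  assumes s: "0 < s" "s < 1"
  shows "(\<lambda>k. inv_qexp_coeff r k * s powi k) summable_on UNIV"
proof -
  have "(\<lambda>n. 1 / qpoch r r n) \<longlonglongrightarrow> 1 / qexp r r"
    using qpoch_tendsto_qexp[OF r] qexp_nonzero[OF r, of r] r by (intro tendsto_intros) auto
  then obtain M where M: "\<And>n. norm (1 / qpoch r r n) \<le> M"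
    by (metis Bseq_def convergentI convergent_imp_Bseq)
  have "summable (\<lambda>n. M * s ^ n)"
    using s by (intro summable_mult summable_geometric) auto
  then have "summable (\<lambda>n. norm (1 / qpoch r r n * s ^ n))"
  proof (rule summable_comparison_test'[where N = 0])
    show "norm (norm (1 / qpoch r r n * s ^ n)) \<le> M * s ^ n" for n
      using mult_right_mono[OF M[of n], of "s ^ n"] s by (simp add: norm_mult)
  qed
  then have "(\<lambda>n. 1 / qpoch r r n * s ^ n) summable_on UNIV"
    by (rule norm_summable_imp_summable_on)
  then have "(\<lambda>k. if k < 0 then 0 else 1 / qpoch r r (nat k) * s ^ nat k) summable_on UNIV"
    by (rule summable_on_int_nonneg)
  also have "(\<lambda>k. if k < 0 then 0 else 1 / qpoch r r (nat k) * s ^ nat k)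
    = (\<lambda>k. inv_qexp_coeff r k * s powi k)"
    by (auto simp: inv_qexp_coeff_def power_int_def)
  finally show ?thesis .
qed

text \<open>The powers of \<open>s\<close> combine to \<open>s powi p\<close>, which leaves the
  finite sum expressing that the two series are inverse.\<close>

lemma convolution_qexp_inv_qexp:
  assumes "s \<noteq> 0"
  shows "(\<Sum>\<^sub>\<infinity>n. (if n < 0 then 0 else qexp_coeff r (nat n) * s ^ nat n)
      * (inv_qexp_coeff r (p - n) * s powi (p - n))) = (if p = 0 then 1 else 0)"
proof -
  have "(\<Sum>\<^sub>\<infinity>n. (if n < 0 then 0 else qexp_coeff r (nat n) * s ^ nat n)
      * (inv_qexp_coeff r (p - n) * s powi (p - n)))
      = (\<Sum>\<^sub>\<infinity>k::int. if k < 0 then 0 else (qexp_coeff r (nat k) * s ^ nat k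
      * (inv_qexp_coeff r (p - int (nat k)) * s powi (p - int (nat k)))))"
    by (rule infsum_cong) auto
  also have "\<dots> = (\<Sum>\<^sub>\<infinity>n. qexp_coeff r n * s ^ n
      * (inv_qexp_coeff r (p - int n) * s powi (p - int n)))"
    by (rule infsum_int_nonneg)
  also have "\<dots> = (\<Sum>\<^sub>\<infinity>n. s powi p * (qexp_coeff r n * inv_qexp_coeff r (p - int n)))"
    using assms by (intro infsum_cong) (simp add: power_int_diff)
  also have "\<dots> = s powi p * (\<Sum>\<^sub>\<infinity>n. qexp_coeff r n * inv_qexp_coeff r (p - int n))"
    by (rule infsum_cmult_right')
  also have "(\<Sum>\<^sub>\<infinity>n. qexp_coeff r n * inv_qexp_coeff r (p - int n)) = (if p = 0 then 1 else 0)"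
  proof (cases "p < 0")
    case True
    then show ?thesis by (simp add: inv_qexp_coeff_def)
  next
    case False
    then obtain k where p: "p = int k" by (metis nonneg_int_cases not_less)
    \<comment> \<open>Terms with \<open>n > k\<close> vanish because \<open>inv_qexp_coeff\<close>
      is zero at negative indices.\<close>
    have "(\<Sum>\<^sub>\<infinity>n. qexp_coeff r n * inv_qexp_coeff r (p - int n))
       = (\<Sum>\<^sub>\<infinity>n\<in>{..k}. qexp_coeff r n / qpoch r r (k - n))"
      by (rule infsum_cong_neutral) (auto simp: p inv_qexp_coeff_def simp flip: of_nat_diff)
    then show ?thesis
      by (simp add: sum_qexp_coeff_qpoch[OF r] p)
  qed
  finally show ?thesis by simp
qed

text \<open>The powers combine as \<open>s^m s^(m + k) = s^k (s^2)^m\<close>; with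
  \<open>s^2 = q^(2\<nu> + 2)\<close> this is the series produced by the Bessel function.\<close>

lemma correlation_qexp:
  assumes "s \<noteq> 0"
  shows "correlation (\<lambda>n. if n < 0 then 0 else qexp_coeff r (nat n) * s ^ nat n)
      (\<lambda>k. inv_qexp_coeff r k * s powi k) k
    = s powi k * (\<Sum>\<^sub>\<infinity>m. qexp_coeff r m * (s\<^sup>2) ^ m * inv_qexp_coeff r (k + int m))"
proof -
  have "correlation (\<lambda>n. if n < 0 then 0 else qexp_coeff r (nat n) * s ^ nat n)
      (\<lambda>k. inv_qexp_coeff r k * s powi k) k
      = (\<Sum>\<^sub>\<infinity>i::int. if i < 0 then 0 else (qexp_coeff r (nat i) * s ^ nat i
      * (inv_qexp_coeff r (int (nat i) + k) * s powi (int (nat i) + k))))"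
    unfolding correlation_def by (rule infsum_cong) auto
  also have "\<dots> = (\<Sum>\<^sub>\<infinity>m. qexp_coeff r m * s ^ m
      * (inv_qexp_coeff r (int m + k) * s powi (int m + k)))"
    by (rule infsum_int_nonneg)
  also have "\<dots> = (\<Sum>\<^sub>\<infinity>m. s powi k * (qexp_coeff r m * (s\<^sup>2) ^ m * inv_qexp_coeff r (k + int m)))"
    using assms by (intro infsum_cong)
      (simp add: power_int_add power2_eq_square power_mult_distrib add.commute)
  also have "\<dots> = s powi k * (\<Sum>\<^sub>\<infinity>m. qexp_coeff r m * (s\<^sup>2) ^ m * inv_qexp_coeff r (k + int m))"
    by (rule infsum_cmult_right')
  finally show ?thesis .
qed

end

section \<open>The \<open>q\<close>-Bessel transform as a Hankel operator\<close>

context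
  fixes q \<nu> :: real
  assumes q: "0 < q" "q < 1" and \<nu>: "\<nu> > -1"
begin

lemma qsq: "0 < q\<^sup>2" "q\<^sup>2 < 1"
  using q by (auto simp: power_less_one_iff)

lemma scale: "0 < q powr (\<nu> + 1)" "q powr (\<nu> + 1) < 1" "q powr (2 * \<nu> + 2) = (q powr (\<nu> + 1))\<^sup>2"
proof -
  show "q powr (\<nu> + 1) < 1"
    using q \<nu> powr_less_mono'[of q 0 "\<nu> + 1"] by simp
  show "q powr (2 * \<nu> + 2) = (q powr (\<nu> + 1))\<^sup>2"
    by (simp add: power2_eq_square flip: powr_add)
qed (use q in simp)

text \<open>Both sides are \<open>q^(n (2\<nu> + 2))\<close>. Writing the weight as a square turns
  weighted \<open>L^2\<close> norms into plain square sums.\<close>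

lemma jackson_weight:
  "q powi n * (q powi n) powr (2 * \<nu> + 1) = ((q powr (\<nu> + 1)) powi n)\<^sup>2"
proof -
  have powi: "x powi n = x powr n" if "x > 0" for x :: real
    using that by (simp add: powr_real_of_int')
  have "q powi n * (q powi n) powr (2 * \<nu> + 1) = q powr (n * (2 * \<nu> + 2))"
    using q by (simp add: powi powr_powr algebra_simps flip: powr_add)
  also have "\<dots> = ((q powr (\<nu> + 1)) powi n)\<^sup>2"
    using q by (simp add: powi powr_powr power2_eq_square algebra_simps flip: powr_add)
  finally show ?thesis .
qed

text \<open>The factor \<open>1 / (1 - q)\<close> of \<open>qbessel_const\<close> is absent, since
  it cancels against the Jackson integral.\<close>

definition qbessel_kernel :: "int \<Rightarrow> real" where
  "qbessel_kernel k = qpoch_inf (q powr (2 * \<nu> + 2)) (q\<^sup>2) / qpoch_inf (q\<^sup>2) (q\<^sup>2)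
     * (q powr (\<nu> + 1)) powi k * qbessel q \<nu> (q powi k)"

text \<open>The exchange of summations moves the parameter \<open>a = q^(2\<nu> + 2)\<close> from
  the shifted factorials into the powers; the factors \<open>qexp r (z * r ^ m)\<close> then lie on
  the lattice covered by \<open>qexp_powi\<close>.\<close>

lemma qbessel_kernel_eq_correlation:
  defines "r \<equiv> q\<^sup>2" and "s \<equiv> q powr (\<nu> + 1)"
  shows "qbessel_kernel k = correlation (\<lambda>n. if n < 0 then 0 else qexp_coeff r (nat n) * s ^ nat n)
      (\<lambda>k. inv_qexp_coeff r k * s powi k) k"
proof -
  note r = qsq[folded r_def] and s = scale[folded s_def]
  define a where "a = s\<^sup>2"
  have a: "0 \<le> a" "a < 1"
    using s by (auto simp: a_def power_less_one_iff)
  \<comment> \<open>The extra power of \<open>r\<close> comes from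
    \<open>q^(n(n+1)) = r^(n(n-1)/2) r^n\<close>, of which Euler's coefficient absorbs only the
    first factor.\<close>
  define z where "z = r powi (k + 1)"
  define S where "S = (\<Sum>\<^sub>\<infinity>m. qexp_coeff r m * a ^ m * qexp r (z * r ^ m))"
  \<comment> \<open>The denominator \<open>qpoch a r n\<close> is rewritten as
    \<open>qexp r a / qexp r (a * r ^ n)\<close>.\<close>
  have J_term: "(- 1) ^ n * (q ^ (n * (n + 1)) / (qpoch a r n * qpoch r r n)) * (q powi k) ^ (2 * n)
      = qexp_coeff r n * z ^ n * qexp r (a * r ^ n) / qexp r a" for n
  proof -
    have "n * (n + 1) = 2 * (n * (n - 1) div 2) + 2 * n"
      by (cases n) (auto simp: algebra_simps)
    then have "q ^ (n * (n + 1)) = r ^ (n * (n - 1) div 2) * r ^ n"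
      by (simp add: r_def power_add power_mult)
    moreover have "(q powi k) ^ (2 * n) = (r powi k) ^ n"
      by (simp add: r_def power_mult power_int_mult_distrib power2_eq_square)
    moreover have "z = r powi k * r"
      using r by (simp add: z_def power_int_add)
    moreover have "qexp r a = qpoch a r n * qexp r (a * r ^ n)"
      by (rule qexp_eq_qpoch_mult[OF r])
    moreover have "qexp r a \<noteq> 0"
      using a by (intro qexp_nonzero[OF r])
    ultimately show ?thesis
      by (simp add: qexp_coeff_def power_mult_distrib mult_ac)
  qed
  have "qbessel q \<nu> (q powi k) = (\<Sum>n. qexp_coeff r n * z ^ n * qexp r (a * r ^ n) / qexp r a)"
    unfolding qbessel_def s(3) by (simp only: J_term flip: r_def a_def)
  also have "\<dots> = S / qexp r a"
    using sums_divide[OF has_sum_imp_sums[OF has_sum_qexp_exchange[OF r]], of z a]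
    by (simp add: S_def sums_iff)
  finally have J: "qexp r a * qbessel q \<nu> (q powi k) = S"
    using qexp_nonzero[OF r a] by simp
  have "S = (\<Sum>\<^sub>\<infinity>m. qexp r r * (qexp_coeff r m * a ^ m * inv_qexp_coeff r (k + int m)))"
    unfolding S_def
  proof (rule infsum_cong)
    fix m
    have "z * r ^ m = r powi (k + int m + 1)"
      using r by (simp add: z_def power_int_add)
    then show "qexp_coeff r m * a ^ m * qexp r (z * r ^ m)
        = qexp r r * (qexp_coeff r m * a ^ m * inv_qexp_coeff r (k + int m))"
      by (simp add: qexp_powi[OF r])
  qed
  then have "S = qexp r r * (\<Sum>\<^sub>\<infinity>m. qexp_coeff r m * a ^ m * inv_qexp_coeff r (k + int m))"
    by (simp only: infsum_cmult_right')
  moreover have "qexp r r \<noteq> 0"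
    using r by (intro qexp_nonzero[OF r]) auto
  moreover have "qbessel_kernel k = qexp r a / qexp r r * s powi k * qbessel q \<nu> (q powi k)"
    using r a unfolding qbessel_kernel_def s(3)
    by (simp add: qpoch_inf_eq_qexp[OF r] flip: r_def s_def a_def)
  ultimately show ?thesis
    using J correlation_qexp[OF r, of s k] s(1) by (simp add: field_simps flip: a_def)
qed

lemma summable_on_qexp_int: "(\<lambda>n::int. if n < 0 then 0 else qexp_coeff (q\<^sup>2) (nat n) * s ^ nat n) summable_on UNIV"
  using has_sum_qexp[OF qsq, of s] by (intro summable_on_int_nonneg has_sum_imp_summable)

lemma summable_on_qbessel_kernel: "qbessel_kernel summable_on UNIV"
  using summable_on_correlation[OF summable_on_inv_qexp[OF qsq scale(1,2)] summable_on_qexp_int[of "q powr (\<nu> + 1)"]]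
  by (simp only: flip: qbessel_kernel_eq_correlation[THEN ext])

lemma qbessel_kernel_orthogonal:
  "(\<Sum>\<^sub>\<infinity>k. qbessel_kernel k * qbessel_kernel (k + d)) = (if d = 0 then 1 else 0)"
  unfolding qbessel_kernel_eq_correlation
  using scale(1)
  by (intro correlation_orthogonal summable_on_inv_qexp[OF qsq scale(1,2)] summable_on_qexp_int
       convolution_qexp_inv_qexp[OF qsq]) simp

text \<open>Of the weight \<open>s^(2m)\<close>, one factor \<open>s^m\<close> joins
  \<open>s^n\<close> in the kernel and the other stays with \<open>f\<close>, so the kernel depends
  on \<open>n + m\<close> alone.\<close>

lemma qbessel_fourier_eq_kernel:
  "qbessel_fourier q \<nu> f (q powi n) * (q powr (\<nu> + 1)) powi n
    = (\<Sum>\<^sub>\<infinity>m. qbessel_kernel (n + m) * (f (q powi m) * (q powr (\<nu> + 1)) powi m))"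
proof -
  define C where "C = qpoch_inf (q powr (2 * \<nu> + 2)) (q\<^sup>2) / qpoch_inf (q\<^sup>2) (q\<^sup>2)"
  define s where "s = q powr (\<nu> + 1)"
  have s: "s \<noteq> 0" using scale(1) by (simp add: s_def)
  have "qbessel_fourier q \<nu> f (q powi n) * s powi n
     = C * s powi n * (\<Sum>\<^sub>\<infinity>m. q powi m * (f (q powi m) * qbessel q \<nu> (q powi n * q powi m) * (q powi m) powr (2 * \<nu> + 1)))"
    using q by (simp add: qbessel_fourier_def qbessel_const_def jackson_integral_def C_def)
  also have "\<dots> = (\<Sum>\<^sub>\<infinity>m. C * s powi n * (q powi m * (f (q powi m) * qbessel q \<nu> (q powi n * q powi m) * (q powi m) powr (2 * \<nu> + 1))))"
    by (rule infsum_cmult_right'[symmetric])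
  also have "\<dots> = (\<Sum>\<^sub>\<infinity>m. qbessel_kernel (n + m) * (f (q powi m) * s powi m))"
  proof (rule infsum_cong)
    fix m
    have "C * s powi n * (q powi m * (f (q powi m) * qbessel q \<nu> (q powi n * q powi m) * (q powi m) powr (2 * \<nu> + 1)))
      = C * s powi n * (f (q powi m) * qbessel q \<nu> (q powi n * q powi m)) * (q powi m * (q powi m) powr (2 * \<nu> + 1))"
      by simp
    also have "\<dots> = C * s powi n * (f (q powi m) * qbessel q \<nu> (q powi (n + m))) * (s powi m)\<^sup>2"
      unfolding jackson_weight using q by (simp add: s_def power_int_add)
    also have "\<dots> = qbessel_kernel (n + m) * (f (q powi m) * s powi m)"
      using s by (simp add: qbessel_kernel_def power_int_add power2_eq_square[of "s powi m"] flip: C_def s_def)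
    finally show "C * s powi n * (q powi m * (f (q powi m) * qbessel q \<nu> (q powi n * q powi m) * (q powi m) powr (2 * \<nu> + 1)))
      = qbessel_kernel (n + m) * (f (q powi m) * s powi m)" .
  qed
  finally show ?thesis by (simp add: s_def)
qed

lemma jackson_term:
  "q powi n * (\<bar>f (q powi n)\<bar> powr p * (q powi n) powr (2 * \<nu> + 1))
    = \<bar>f (q powi n)\<bar> powr p * ((q powr (\<nu> + 1)) powi n)\<^sup>2"
  using jackson_weight[of n] by (simp add: mult_ac)

lemma qLp_iff:
  "f \<in> qLp q p \<nu> \<longleftrightarrow> (\<lambda>n. \<bar>f (q powi n)\<bar> powr p * ((q powr (\<nu> + 1)) powi n)\<^sup>2) summable_on UNIV"
  by (simp add: qLp_def qnorm_def Let_def jackson_integrable_def jackson_term)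

text \<open>The \<open>has_sum\<close> premise selects the finite branch of
  \<open>qnorm\<close>.\<close>

lemma qnorm_2:
  assumes "((\<lambda>n. (f (q powi n) * (q powr (\<nu> + 1)) powi n)\<^sup>2) has_sum S) UNIV"
  shows "qnorm q 2 \<nu> f = ennreal (((1 - q) * S) powr (1 / 2))"
proof -
  have "\<bar>y\<bar> powr 2 * w\<^sup>2 = (y * w)\<^sup>2" for y w :: real
    by (cases "y = 0") (auto simp: power_mult_distrib)
  then show ?thesis
    using assms
    unfolding qnorm_def Let_def jackson_integrable_def jackson_integral_def jackson_term
    by (simp only: has_sum_iff) simp
qed

end

text \<open>For \<open>y \<le> 1\<close> the first term dominates \<open>y^2\<close>, otherwise the
  second. The form \<open>y powr 1\<close> matches the series defining
  \<open>qLp q 1 \<nu>\<close>.\<close>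

lemma square_le_add_powr:
  fixes y p :: real
  assumes "0 \<le> y" "2 \<le> p"
  shows "y\<^sup>2 \<le> y powr 1 + y powr p"
proof (cases "y \<le> 1")
  case True
  then have "y\<^sup>2 \<le> y"
    using assms mult_left_le[of y y] by (simp add: power2_eq_square)
  then show ?thesis using assms by (simp add: add_increasing2)
next
  case False
  then have "y powr 2 \<le> y powr p"
    using assms by (intro powr_mono) auto
  then show ?thesis using assms False by simp
qed

theorem theorem2:
  fixes q \<nu> p :: real and f :: "real \<Rightarrow> real"
  assumes "0 < q" and "q < 1" and "\<nu> > -1" and "p > 2"
    and "f \<in> qLp q 1 \<nu> \<inter> qLp q p \<nu>"
  shows "qnorm q 2 \<nu> (qbessel_fourier q \<nu> f) = qnorm q 2 \<nu> f"
proof -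
  note q\<nu> = assms(1-3)
  define s where "s = q powr (\<nu> + 1)"
  define u where "u = (\<lambda>n. f (q powi n) * s powi n)"
  \<comment> \<open>The sum of the two series given by membership in \<open>L^1\<close> and
    \<open>L^p\<close> majorizes the squares of \<open>u\<close>.\<close>
  have "(\<lambda>n. \<bar>f (q powi n)\<bar> powr 1 * (s powi n)\<^sup>2 + \<bar>f (q powi n)\<bar> powr p * (s powi n)\<^sup>2) summable_on UNIV"
    using assms(5) unfolding s_def by (intro summable_on_add) (auto simp only: Int_iff qLp_iff[OF q\<nu>])
  then have u: "(\<lambda>n. (u n)\<^sup>2) summable_on UNIV"
  proof (rule summable_on_real_comparison)
    fix n
    show "\<bar>(u n)\<^sup>2\<bar> \<le> \<bar>f (q powi n)\<bar> powr 1 * (s powi n)\<^sup>2 + \<bar>f (q powi n)\<bar> powr p * (s powi n)\<^sup>2"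
      using mult_right_mono[OF square_le_add_powr[of "\<bar>f (q powi n)\<bar>" p], of "(s powi n)\<^sup>2"] assms(4)
      by (simp add: u_def power_mult_distrib distrib_right)
  qed
  have "((\<lambda>n. (\<Sum>\<^sub>\<infinity>m. qbessel_kernel q \<nu> (n + m) * u m)\<^sup>2) has_sum (\<Sum>\<^sub>\<infinity>n. (u n)\<^sup>2)) UNIV"
    using summable_on_qbessel_kernel[OF q\<nu>] qbessel_kernel_orthogonal[OF q\<nu>] u
    by (rule hankel_isometry)
  then have "qnorm q 2 \<nu> (qbessel_fourier q \<nu> f) = ennreal (((1 - q) * (\<Sum>\<^sub>\<infinity>n. (u n)\<^sup>2)) powr (1 / 2))"
    by (intro qnorm_2[OF q\<nu>]) (simp only: qbessel_fourier_eq_kernel[OF q\<nu>] u_def s_def)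
  moreover have "qnorm q 2 \<nu> f = ennreal (((1 - q) * (\<Sum>\<^sub>\<infinity>n. (u n)\<^sup>2)) powr (1 / 2))"
    using has_sum_infsum[OF u] by (intro qnorm_2[OF q\<nu>]) (simp only: u_def s_def)
  ultimately show ?thesis by simp
qed

end
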